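(* For every positive integer $L$, $$\sum_{n,m\ge 0}\binom{m}{2}a_2(L,m,n)q^n=\frac{1}{(q;q^2)_L}\Bigg(q^5\frac{1-q^{2L-2}}{1-q^2}+(q^6+q^8)\frac{1-q^{4L-4}}{1-q^4}+q^8\begin{bmatrix}L-1\\2\end{bmatrix}_{q^2}$$ $$+q^{11}\frac{1-q^2}{1-q^{2L}}\begin{bmatrix}L\\3\end{bmatrix}_{q^2}\big((1+q^2)(1+q^{2L-2})+q^2+q^{2L}\big)+q^{16}\begin{bmatrix}L-1\\2\end{bmatrix}_{q^4}\Bigg).$$
   Context: A partition of $n$ is a non-increasing finite sequence of positive integers summing to $n$ (the empty partition is the unique partition of $0$). Its Young diagram has $\lambda_i$ left-justified cells in row $i$; with $\lambda'_j$ the number of cells in column $j$, the hook length of cell $(i,j)$ is $h(i,j)=\lambda_i+\lambda'_j-i-j+1$. For a positive integer $L$, $a_2(L,m,n)$ is the number of partitions of $n$ into odd parts with largest part at most $2L-1$ whose Young diagram has exactly $m$ cells of hook length $2$. Notation: $(a;q)_L=\prod_{k=0}^{L-1}(1-aq^k)$; the Gaussian binomial coefficient is $\begin{bmatrix}M\\N\end{bmatrix}_q=\frac{(q;q)_M}{(q;q)_N(q;q)_{M-N}}$ for $M\ge N\ge 0$ and $0$ otherwise. The identity is one of formal power series in $q$.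
   Formalization: The last summand q^{2L} in the factor (1+q^2)(1+q^{2L-2})+q^2+q^{2L} is corrected to q^{2L-2}; as printed the identity fails for every L≥3 (for L=3 the coefficients of q^15 differ by 1), while for L=1,2 both versions agree. *)

theory Defs
  imports "HOL-Analysis.Analysis"
begin

definition is_partition :: "nat \<Rightarrow> nat list \<Rightarrow> bool" where
  "is_partition n lam \<longleftrightarrow>
     sorted_wrt (\<ge>) lam \<and> (\<forall>p\<in>set lam. p > 0) \<and> sum_list lam = n"

text \<open>Rows, columns and parts are numbered from 1, while list positions start at 0.\<close>

definition part :: "nat list \<Rightarrow> nat \<Rightarrow> nat" where
  "part lam i = lam ! (i - 1)"

definition young_diagram :: "nat list \<Rightarrow> (nat \<times> nat) set" where
  "young_diagram lam = {(i, j). 1 \<le> i \<and> i \<le> length lam \<and> 1 \<le> j \<and> j \<le> part lam i}"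

definition col_length :: "nat list \<Rightarrow> nat \<Rightarrow> nat" where
  "col_length lam j = card {i. (i, j) \<in> young_diagram lam}"

definition hook_length :: "nat list \<Rightarrow> nat \<times> nat \<Rightarrow> int" where
  "hook_length lam = (\<lambda>(i, j). int (part lam i) + int (col_length lam j) - int i - int j + 1)"

definition a2 :: "nat \<Rightarrow> nat \<Rightarrow> nat \<Rightarrow> nat" where
  "a2 L m n = card {lam. is_partition n lam \<and> (\<forall>p\<in>set lam. odd p \<and> p \<le> 2 * L - 1)
                       \<and> card {c \<in> young_diagram lam. hook_length lam c = 2} = m}"

definition qpoch :: "'a::comm_ring_1 \<Rightarrow> 'a \<Rightarrow> nat \<Rightarrow> 'a" where
  "qpoch a q L = (\<Prod>k<L. 1 - a * q ^ k)"

text \<open>The base \<^term>\<open>q\<close> is a power series; for bases with zero constant coefficient, such as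
  positive powers of \<^term>\<open>fps_X\<close>, the denominator is a unit of the power series ring.\<close>

definition qbinom :: "rat fps \<Rightarrow> nat \<Rightarrow> nat \<Rightarrow> rat fps" where
  "qbinom q M N = (if N \<le> M then qpoch q q M / (qpoch q q N * qpoch q q (M - N)) else 0)"

end

theory Submission
  imports Defs
begin

text \<open>
  In a partition into odd parts, a cell of hook length 2 has either arm 1 and leg 0 or arm 0 and
  leg 1. The former lies in the last row of each part size at least 3, the latter in the
  next-to-last row of each repeated part size. So \<open>m\<close> is a sum of contributions of the individual
  part sizes, and Vandermonde's identity makes the generating functions of the binomial moments of
  \<open>m\<close> computable one part size at a time. After multiplication by \<open>(q;q\<^sup>2)\<^sub>L\<close> the second moment
  becomes \<open>\<Sum>\<^bsub>p<r\<^esub> A\<^sub>p A\<^sub>r + \<Sum>\<^bsub>p\<ge>3\<^esub> q\<^sup>2\<^sup>p\<close> with \<open>A\<^sub>1 = q\<^sup>2\<close> and \<open>A\<^sub>p = q\<^sup>p + q\<^sup>2\<^sup>p\<close> for \<open>p \<ge> 3\<close>, where \<open>p\<close>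
  and \<open>r\<close> range over the odd numbers up to \<open>2L - 1\<close>. Summing geometric series, with
  \<open>Y = q\<^bsup>2L-2\<^esup>\<close>, gives the closed form.
\<close>

subsection \<open>Hooks of length two\<close>

definition two_hooks :: "nat list \<Rightarrow> nat" where
  "two_hooks lam = card {c \<in> young_diagram lam. hook_length lam c = 2}"

lemma finite_young_diagram: "finite (young_diagram lam)"
proof -
  have "young_diagram lam \<subseteq> (SIGMA i:{1..length lam}. {1..part lam i})"
    by (auto simp: young_diagram_def)
  then show ?thesis
    by (rule finite_subset) auto
qed

text \<open>Counting entries instead of row indices lets column lengths be computed along
  \<open>#\<close> and \<open>@\<close>. Column 0 has no cells and must be excluded.\<close>

lemma col_length_eq_length_filter:
  assumes "j \<ge> 1"
  shows "col_length lam j = length (filter (\<lambda>p. j \<le> p) lam)"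
proof -
  have "{i. (i, j) \<in> young_diagram lam} = Suc ` {i. i < length lam \<and> j \<le> lam ! i}"
  proof (intro equalityI subsetI)
    fix i assume "i \<in> {i. (i, j) \<in> young_diagram lam}"
    then have "i - 1 < length lam" "j \<le> lam ! (i - 1)" "i = Suc (i - 1)"
      by (auto simp: young_diagram_def part_def)
    then show "i \<in> Suc ` {i. i < length lam \<and> j \<le> lam ! i}"
      by blast
  qed (use assms in \<open>auto simp: young_diagram_def part_def\<close>)
  then show ?thesis
    by (simp add: col_length_def length_filter_conv_card card_image)
qed

lemma young_diagram_Cons:
  "young_diagram (x # mu) = Pair 1 ` {1..x} \<union> map_prod Suc id ` young_diagram mu"
proof (intro equalityI subsetI)
  fix c assume c: "c \<in> young_diagram (x # mu)"
  obtain i j where [simp]: "c = (i, j)"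
    by (cases c)
  show "c \<in> Pair 1 ` {1..x} \<union> map_prod Suc id ` young_diagram mu"
  proof (cases "i = 1")
    case True
    then show ?thesis
      using c by (auto simp: young_diagram_def part_def)
  next
    case False
    then obtain i' where i': "i = Suc i'" "i' \<ge> 1"
      using c by (cases i) (auto simp: young_diagram_def)
    then have "(i', j) \<in> young_diagram mu"
      using c by (auto simp: young_diagram_def part_def nth_Cons')
    then show ?thesis
      using i' by force
  qed
qed (auto simp: young_diagram_def part_def nth_Cons')

lemma hook_length_first_row:
  assumes "1 \<le> j" "j \<le> x"
  shows "hook_length (x # mu) (1, j) = int (x - j) + int (length (filter (\<lambda>p. j \<le> p) mu)) + 1"
  using assms by (simp add: hook_length_def part_def col_length_eq_length_filter)

text \<open>A row added on top raises the row index and the column length by one each, which cancel.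
  Sortedness gives \<open>j \<le> x\<close>, so the new row does reach column
  \<open>j\<close>.\<close>

lemma hook_length_Cons:
  assumes "(i, j) \<in> young_diagram mu" "sorted_wrt (\<ge>) (x # mu)"
  shows "hook_length (x # mu) (Suc i, j) = hook_length mu (i, j)"
proof -
  have ij: "1 \<le> i" "i \<le> length mu" "1 \<le> j" "j \<le> part mu i"
    using assms(1) by (auto simp: young_diagram_def)
  then have "part mu i \<in> set mu"
    by (auto simp: part_def)
  then have "j \<le> x"
    using assms(2) ij by auto
  then show ?thesis
    using ij by (simp add: hook_length_def part_def col_length_eq_length_filter nth_Cons')
qed

text \<open>Only the new first row can add cells, and there arm plus leg must be 1: arm 1 and leg 0
  occur in column \<open>x - 1\<close>, arm 0 and leg 1 in column \<open>x\<close>.\<close>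

lemma two_hooks_Cons:
  assumes "sorted_wrt (\<ge>) (x # mu)" "x > 0"
  shows "two_hooks (x # mu) = two_hooks mu
           + of_bool (2 \<le> x \<and> filter (\<lambda>p. x - 1 \<le> p) mu = [])
           + of_bool (length (filter (\<lambda>p. x \<le> p) mu) = 1)"
proof -
  let ?len = "\<lambda>j. length (filter (\<lambda>p. j \<le> p) mu)"
  define A where "A = {j \<in> {1..x}. x - j + ?len j = 1}"
  define B where "B = {c \<in> young_diagram mu. hook_length mu c = 2}"
  have "{c \<in> young_diagram (x # mu). hook_length (x # mu) c = 2}
          = Pair 1 ` A \<union> map_prod Suc id ` B"
    unfolding young_diagram_Cons A_def B_def
    using hook_length_Cons[OF _ assms(1)]
    by (auto simp del: One_nat_def simp: hook_length_first_row)
  moreover have "Pair 1 ` A \<inter> map_prod Suc id ` B = {}"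
    by (auto simp: B_def young_diagram_def)
  moreover have "finite A" "finite B"
    using finite_young_diagram by (auto simp: A_def B_def)
  moreover have "inj_on (map_prod Suc id) B"
    by (auto simp: inj_on_def)
  ultimately have "two_hooks (x # mu) = card A + two_hooks mu"
    by (simp add: two_hooks_def card_Un_disjoint card_image inj_on_def B_def)
  moreover have "card A = of_bool (2 \<le> x \<and> ?len (x - 1) = 0) + of_bool (?len x = 1)"
  proof -
    define P Q where "P \<longleftrightarrow> 2 \<le> x \<and> ?len (x - 1) = 0" and "Q \<longleftrightarrow> ?len x = 1"
    \<comment> \<open>For \<open>x = 1\<close> the column \<open>x - 1\<close> is 0 and lies outside
      the diagram, whence the condition \<open>2 \<le> x\<close>.\<close>
    have "j \<in> A \<longleftrightarrow> j = x - 1 \<and> 2 \<le> x \<and> ?len j = 0 \<or> j = x \<and> ?len j = 1" for j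
      unfolding A_def mem_Collect_eq atLeastAtMost_iff using assms(2) by arith
    then have "j \<in> A \<longleftrightarrow> j = x - 1 \<and> P \<or> j = x \<and> Q" for j
      unfolding P_def Q_def by (simp only: cong: conj_cong)
    then have "A = (if P then {x - 1} else {}) \<union> (if Q then {x} else {})"
      by auto
    then show ?thesis
      unfolding P_def[symmetric] Q_def[symmetric] using assms(2) by simp
  qed
  ultimately show ?thesis
    by simp
qed

lemma sorted_wrt_replicate_append:
  fixes p :: "'a::order"
  assumes "sorted_wrt (\<ge>) mu" "\<forall>y\<in>set mu. y \<le> p"
  shows "sorted_wrt (\<ge>) (replicate j p @ mu)"
  using assms by (induction j) auto

text \<open>The contribution to \<^term>\<open>two_hooks\<close> of an odd part size \<open>p\<close> of multiplicity \<open>j\<close>.\<close>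

definition block_hooks :: "nat \<Rightarrow> nat \<Rightarrow> nat" where
  "block_hooks p j = of_bool (2 \<le> p \<and> 1 \<le> j) + of_bool (2 \<le> j)"

text \<open>A gap of at least 2, as between distinct odd parts, keeps \<open>mu\<close> out of
  columns \<open>p - 1\<close> and \<open>p\<close>. So the first copy of \<open>p\<close> adds an
  arm-1 hook if \<open>p \<ge> 2\<close>, the second a leg-1 hook, and later copies nothing.\<close>

lemma two_hooks_replicate_append:
  assumes "sorted_wrt (\<ge>) mu" "\<And>y. y \<in> set mu \<Longrightarrow> y + 1 < p" "p > 0"
  shows "two_hooks (replicate j p @ mu) = two_hooks mu + block_hooks p j"
proof (induction j)
  case (Suc j)
  have 1: "filter (\<lambda>y. p - 1 \<le> y) mu = []" "filter (\<lambda>y. p \<le> y) mu = []"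
    using assms(2) by (fastforce simp: filter_empty_conv)+
  have "\<forall>y\<in>set mu. y \<le> p"
    using assms(2) by fastforce
  then have "sorted_wrt (\<ge>) (p # replicate j p @ mu)"
    using sorted_wrt_replicate_append[OF assms(1), of p "Suc j"] by simp
  from two_hooks_Cons[OF this assms(3)] show ?case
    using Suc.IH 1 by (auto simp: block_hooks_def)
qed (simp add: block_hooks_def)


subsection \<open>Generating functions of binomial moments\<close>

definition odd_partitions :: "nat \<Rightarrow> nat \<Rightarrow> nat list set" where
  "odd_partitions L n = {lam. is_partition n lam \<and> (\<forall>p\<in>set lam. odd p \<and> p \<le> 2 * L - 1)}"

lemma finite_odd_partitions: "finite (odd_partitions L n)"
proof -
  have "length lam \<le> sum_list lam" if "\<forall>p\<in>set lam. p > 0" for lam :: "nat list"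
    using that by (induction lam) auto
  then have "odd_partitions L n \<subseteq> {lam. set lam \<subseteq> {..n} \<and> length lam \<le> n}"
    by (auto simp: odd_partitions_def is_partition_def member_le_sum_list)
  then show ?thesis
    by (rule finite_subset) (simp add: finite_lists_length_le)
qed

lemma odd_partitions_0: "odd_partitions 0 n = (if n = 0 then {[]} else {})"
proof -
  have "lam = []" if "lam \<in> odd_partitions 0 n" for lam
    using that by (cases lam) (auto simp: odd_partitions_def is_partition_def)
  moreover have "[] \<in> odd_partitions 0 n \<longleftrightarrow> n = 0"
    by (auto simp: odd_partitions_def is_partition_def)
  ultimately show ?thesis
    by auto
qed

lemma sorted_eq_replicate_append_filter:
  fixes xs :: "'a::linorder list"
  assumes "sorted_wrt (\<ge>) xs" "\<forall>x\<in>set xs. x \<le> p"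
  shows "xs = replicate (length (filter (\<lambda>x. x = p) xs)) p @ filter (\<lambda>x. x \<noteq> p) xs"
  using assms
proof (induction xs)
  case (Cons x xs)
  show ?case
  proof (cases "x = p")
    case False
    then have "\<forall>y\<in>set xs. y \<noteq> p"
      using Cons.prems by fastforce
    then have "filter (\<lambda>x. x = p) xs = []" "filter (\<lambda>x. x \<noteq> p) xs = xs"
      by (simp_all add: filter_empty_conv)
    then show ?thesis
      using False by simp
  qed (use Cons in simp)
qed simp

text \<open>All copies of the largest admissible part \<open>p\<close> are split off. What is left
  is a partition of some \<open>k\<close> into smaller odd parts, and \<open>k\<close> fixes the
  multiplicity of \<open>p\<close>.\<close>

lemma sum_odd_partitions_Suc:
  fixes f :: "nat list \<Rightarrow> 'a::comm_monoid_add" and L :: nat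
  defines "p \<equiv> 2 * L + 1"
  shows "sum f (odd_partitions (Suc L) n)
           = (\<Sum>k\<le>n. if p dvd n - k
                then \<Sum>mu\<in>odd_partitions L k. f (replicate ((n - k) div p) p @ mu) else 0)"
proof -
  define K where "K = {k. k \<le> n \<and> p dvd n - k}"
  have fin: "finite K"
    by (simp add: K_def)
  have no_p: "p \<notin> set mu" if "mu \<in> odd_partitions L k" for mu k
    using that by (fastforce simp: odd_partitions_def p_def)
  have filter_mu: "filter (\<lambda>x. x \<noteq> p) mu = mu" if "mu \<in> odd_partitions L k" for mu k
    using no_p[OF that] by (auto intro!: filter_True)
  have "sum f (odd_partitions (Suc L) n)
          = (\<Sum>(k, mu)\<in>Sigma K (odd_partitions L). f (replicate ((n - k) div p) p @ mu))"
  proof (rule sum.reindex_bij_witness[where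
          j = "\<lambda>lam. (sum_list (filter (\<lambda>x. x \<noteq> p) lam), filter (\<lambda>x. x \<noteq> p) lam)" and
          i = "\<lambda>(k, mu). replicate ((n - k) div p) p @ mu"])
    fix lam assume lam: "lam \<in> odd_partitions (Suc L) n"
    define mu where "mu = filter (\<lambda>x. x \<noteq> p) lam"
    define j where "j = length (filter (\<lambda>x. x = p) lam)"
    have lam_eq: "lam = replicate j p @ mu"
      unfolding j_def mu_def
      by (rule sorted_eq_replicate_append_filter)
         (use lam in \<open>auto simp: odd_partitions_def is_partition_def p_def\<close>)
    have n: "n = j * p + sum_list mu"
      using lam unfolding odd_partitions_def is_partition_def
      by (subst (asm) lam_eq) (simp add: sum_list_replicate)
    \<comment> \<open>As \<open>2 * L\<close> is even, an odd part below \<open>p\<close> is at most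
      \<open>2 * L - 1\<close>. For \<open>L = 0\<close> this truncated bound is 0 and no such
      \<open>x\<close> exists.\<close>
    have "x \<le> 2 * L - 1" if "x \<in> set mu" for x
    proof -
      have "odd x" "x \<le> 2 * L + 1" "x \<noteq> 2 * L + 1"
        using that lam by (auto simp: mu_def odd_partitions_def p_def)
      then show ?thesis
        by presburger
    qed
    then have mu: "mu \<in> odd_partitions L (sum_list mu)"
      using lam by (auto simp: odd_partitions_def is_partition_def mu_def sorted_wrt_filter)
    have p: "p > 0"
      by (simp add: p_def)
    have j: "(n - sum_list mu) div p = j"
      using p by (simp add: n)
    show "(case (sum_list (filter (\<lambda>x. x \<noteq> p) lam), filter (\<lambda>x. x \<noteq> p) lam) of
            (k, mu) \<Rightarrow> replicate ((n - k) div p) p @ mu) = lam"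
      unfolding mu_def[symmetric] prod.case j by (rule lam_eq[symmetric])
    show "(sum_list (filter (\<lambda>x. x \<noteq> p) lam), filter (\<lambda>x. x \<noteq> p) lam)
            \<in> Sigma K (odd_partitions L)"
      unfolding mu_def[symmetric] using mu n by (simp add: K_def)
    show "(case (sum_list (filter (\<lambda>x. x \<noteq> p) lam), filter (\<lambda>x. x \<noteq> p) lam) of
            (k, mu) \<Rightarrow> f (replicate ((n - k) div p) p @ mu)) = f lam"
      unfolding mu_def[symmetric] prod.case j by (rule arg_cong[OF lam_eq[symmetric]])
  next
    fix kmu assume "kmu \<in> Sigma K (odd_partitions L)"
    then obtain k mu where kmu [simp]: "kmu = (k, mu)" and k: "k \<in> K"
      and mu: "mu \<in> odd_partitions L k"
      by auto
    have sum_mu: "sum_list mu = k"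
      using mu by (simp add: odd_partitions_def is_partition_def)
    have filter_app: "filter (\<lambda>x. x \<noteq> p) (replicate j p @ mu) = mu" for j
      using filter_mu[OF mu] by simp
    show "(sum_list (filter (\<lambda>x. x \<noteq> p) (case kmu of (k, mu) \<Rightarrow> replicate ((n - k) div p) p @ mu)),
           filter (\<lambda>x. x \<noteq> p) (case kmu of (k, mu) \<Rightarrow> replicate ((n - k) div p) p @ mu)) = kmu"
      using sum_mu by (simp only: kmu prod.case filter_app)
    have mu_le: "\<forall>x\<in>set mu. odd x \<and> x > 0 \<and> x \<le> p"
      using mu by (fastforce simp: odd_partitions_def is_partition_def p_def)
    then have "sorted_wrt (\<ge>) (replicate j p @ mu)" for j
      using mu by (intro sorted_wrt_replicate_append) (simp_all add: odd_partitions_def is_partition_def)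
    moreover have "sum_list (replicate ((n - k) div p) p @ mu) = n"
      using k by (simp add: K_def sum_list_replicate sum_mu)
    moreover have "odd p \<and> p > 0 \<and> p = 2 * Suc L - 1"
      by (simp add: p_def)
    then have "\<forall>x\<in>set (replicate j p @ mu). odd x \<and> x > 0 \<and> x \<le> 2 * Suc L - 1" for j
      using mu_le by (metis Un_iff in_set_replicate order_refl set_append)
    ultimately show "(case kmu of (k, mu) \<Rightarrow> replicate ((n - k) div p) p @ mu)
            \<in> odd_partitions (Suc L) n"
      unfolding kmu prod.case odd_partitions_def is_partition_def by blast
  qed
  also have "\<dots> = (\<Sum>k\<in>K. \<Sum>mu\<in>odd_partitions L k. f (replicate ((n - k) div p) p @ mu))"
    using fin finite_odd_partitions by (subst sum.Sigma) auto
  also have "\<dots> = (\<Sum>k\<le>n. if p dvd n - k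
                then \<Sum>mu\<in>odd_partitions L k. f (replicate ((n - k) div p) p @ mu) else 0)"
    unfolding K_def by (simp add: sum.inter_filter flip: atMost_iff)
  finally show ?thesis .
qed

text \<open>Index 0 gives the plain partition count, index 2 the left side of the theorem.\<close>

definition moment_gf :: "nat \<Rightarrow> nat \<Rightarrow> rat fps" where
  "moment_gf i L = Abs_fps (\<lambda>n. of_nat (\<Sum>lam\<in>odd_partitions L n. two_hooks lam choose i))"

text \<open>The moment series for the single part size \<open>p\<close>: the exponent
  \<open>n\<close> stands for \<open>n div p\<close> copies.\<close>

definition block_gf :: "nat \<Rightarrow> nat \<Rightarrow> rat fps" where
  "block_gf i p = Abs_fps (\<lambda>n. if p dvd n then of_nat (block_hooks p (n div p) choose i) else 0)"

lemma moment_gf_0: "moment_gf i 0 = of_bool (i = 0)"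
proof (rule fps_ext)
  fix n
  have "two_hooks [] = 0"
    by (auto simp: two_hooks_def young_diagram_def card_eq_0_iff)
  then show "fps_nth (moment_gf i 0) n = fps_nth (of_bool (i = 0)) n"
    by (cases i) (simp_all add: moment_gf_def odd_partitions_0)
qed

text \<open>Hooks add up over part sizes, so Vandermonde's identity gives the sum over
  \<open>j\<close>, and splitting off the largest part gives a Cauchy product.\<close>

lemma moment_gf_Suc:
  "moment_gf i (Suc L) = (\<Sum>j\<le>i. moment_gf j L * block_gf (i - j) (2 * L + 1))"
proof (rule fps_ext)
  fix n
  let ?p = "2 * L + 1"
  define c :: "nat \<Rightarrow> nat \<Rightarrow> nat" where
    "c = (\<lambda>k j. if ?p dvd n - k then block_hooks ?p ((n - k) div ?p) choose j else 0)"
  have two_hooks_app: "two_hooks (replicate j ?p @ mu) = two_hooks mu + block_hooks ?p j"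
    if "mu \<in> odd_partitions L k" for mu j k
  proof (rule two_hooks_replicate_append)
    fix y assume "y \<in> set mu"
    then have "y \<le> 2 * L - 1" "y > 0"
      using that by (auto simp: odd_partitions_def is_partition_def)
    then show "y + 1 < ?p"
      by linarith
  qed (use that in \<open>auto simp: odd_partitions_def is_partition_def\<close>)
  have "(\<Sum>lam\<in>odd_partitions (Suc L) n. two_hooks lam choose i)
          = (\<Sum>k\<le>n. \<Sum>mu\<in>odd_partitions L k. \<Sum>j\<le>i. (two_hooks mu choose j) * c k (i - j))"
    unfolding sum_odd_partitions_Suc
    by (intro sum.cong refl)
       (auto simp: two_hooks_app[unfolded Suc_eq_plus1[symmetric]] vandermonde c_def intro!: sum.cong)
  also have "\<dots> = (\<Sum>k\<le>n. \<Sum>j\<le>i. (\<Sum>mu\<in>odd_partitions L k. two_hooks mu choose j) * c k (i - j))"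
    by (simp add: sum_distrib_right sum.swap[of _ "{..i}"])
  also have "\<dots> = (\<Sum>j\<le>i. \<Sum>k\<le>n. (\<Sum>mu\<in>odd_partitions L k. two_hooks mu choose j) * c k (i - j))"
    by (rule sum.swap)
  finally have eq: "(\<Sum>lam\<in>odd_partitions (Suc L) n. two_hooks lam choose i)
      = (\<Sum>j\<le>i. \<Sum>k\<le>n. (\<Sum>mu\<in>odd_partitions L k. two_hooks mu choose j) * c k (i - j))" .
  have "fps_nth (moment_gf i (Suc L)) n
      = (\<Sum>j\<le>i. \<Sum>k\<le>n. fps_nth (moment_gf j L) k * of_nat (c k (i - j)))"
    unfolding moment_gf_def fps_nth_Abs_fps eq by simp
  also have "\<dots> = fps_nth (\<Sum>j\<le>i. moment_gf j L * block_gf (i - j) ?p) n"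
    by (auto simp: fps_sum_nth fps_mult_nth atLeast0AtMost block_gf_def c_def intro!: sum.cong)
  finally show "fps_nth (moment_gf i (Suc L)) n = fps_nth (\<Sum>j\<le>i. moment_gf j L * block_gf (i - j) ?p) n" .
qed

text \<open>Multiplying by \<open>1 - fps_X ^ p\<close> takes differences in the multiplicity
  \<open>m\<close>, so \<open>h\<close> only has to record the jumps.\<close>

lemma block_gf_eqI:
  fixes h :: "rat fps"
  assumes "p > 0"
    and "\<And>m. (of_nat (block_hooks p m choose i) :: rat)
             = (if m = 0 then 0 else of_nat (block_hooks p (m - 1) choose i)) + fps_nth h (p * m)"
    and "\<And>n. \<not> p dvd n \<Longrightarrow> fps_nth h n = 0"
  shows "(1 - fps_X ^ p) * block_gf i p = h"
proof (rule fps_ext)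
  fix n
  have eq: "fps_nth ((1 - fps_X ^ p) * block_gf i p) n
          = fps_nth (block_gf i p) n - (if n < p then 0 else fps_nth (block_gf i p) (n - p))"
    by (simp add: algebra_simps fps_X_power_mult_nth)
  show "fps_nth ((1 - fps_X ^ p) * block_gf i p) n = fps_nth h n"
  proof (cases "p dvd n")
    case True
    then obtain m where n: "n = p * m" ..
    show ?thesis
    proof (cases m)
      case (Suc m')
      then show ?thesis
        using assms(1) assms(2)[of m] unfolding eq by (simp add: n block_gf_def)
    qed (use assms(1) assms(2)[of 0] n eq in \<open>simp add: block_gf_def\<close>)
  next
    case False
    then have "\<not> p dvd n - p" if "\<not> n < p"
      using that by (simp add: dvd_diff_nat dvd_minus_self)
    then show ?thesis
      using False assms(3)[OF False] unfolding eq by (auto simp: block_gf_def)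
  qed
qed

text \<open>As the multiplicity grows, \<open>block_hooks p\<close> runs through 0, 1, 2, 2, ... for
  \<open>p \<ge> 2\<close> and through 0, 0, 1, 1, ... for \<open>p = 1\<close>. The right sides
  record the jumps of its binomial coefficients.\<close>

lemma block_gf_times:
  assumes "p > 0"
  shows "(1 - fps_X ^ p) * block_gf 0 p = 1"
    and "(1 - fps_X ^ p) * block_gf 1 p = of_bool (2 \<le> p) * fps_X ^ p + fps_X ^ (2 * p)"
    and "(1 - fps_X ^ p) * block_gf 2 p = of_bool (2 \<le> p) * fps_X ^ (2 * p)"
proof -
  have *: "p * m = p \<longleftrightarrow> m = 1" "p * m = 2 * p \<longleftrightarrow> m = 2" for m
    using assms by auto
  have **: "m - Suc 0 \<ge> 2 \<longleftrightarrow> m \<ge> 2 \<and> m \<noteq> 2" "m - Suc 0 \<ge> Suc 0 \<longleftrightarrow> m \<ge> 2" for m :: nat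
    by auto
  show "(1 - fps_X ^ p) * block_gf 0 p = 1"
    using assms by (intro block_gf_eqI) (auto intro!: Nat.gr0I)
  show "(1 - fps_X ^ p) * block_gf 1 p = of_bool (2 \<le> p) * fps_X ^ p + fps_X ^ (2 * p)"
    using assms by (intro block_gf_eqI) (auto simp: * ** block_hooks_def split: if_splits)
  have choose: "Suc (Suc 0) choose 2 = 1" "Suc 0 choose 2 = 0" "0 choose 2 = 0"
    by (simp_all add: numeral_2_eq_2)
  show "(1 - fps_X ^ p) * block_gf 2 p = of_bool (2 \<le> p) * fps_X ^ (2 * p)"
    using assms by (intro block_gf_eqI) (auto simp: * ** choose block_hooks_def split: if_splits)
qed


subsection \<open>Reduction to elementary symmetric sums\<close>

text \<open>The index \<open>k\<close> stands for the part size \<open>2 * k + 1\<close>.\<close>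

definition weight :: "rat fps \<Rightarrow> nat \<Rightarrow> rat fps" where
  "weight q k = of_bool (1 \<le> k) * q ^ (2 * k + 1) + q ^ (4 * k + 2)"

text \<open>The second elementary symmetric sum of the weights, ordered by the larger index, plus
  the second moments of single part sizes.\<close>

definition pair_weight :: "rat fps \<Rightarrow> nat \<Rightarrow> rat fps" where
  "pair_weight q L = (\<Sum>k<L. (\<Sum>i<k. weight q i) * weight q k + of_bool (1 \<le> k) * q ^ (4 * k + 2))"

lemma qpoch_Suc_odd: "qpoch q (q ^ 2) (Suc L) = qpoch q (q ^ 2) L * (1 - q ^ (2 * L + 1))"
  by (simp add: qpoch_def flip: power_mult)

text \<open>Each factor of the product clears the denominator of one block series. The claims share
  one induction because higher moments draw on lower ones.\<close>

lemma qpoch_moment_gf: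
  fixes L
  defines "D \<equiv> qpoch (fps_X :: rat fps) (fps_X ^ 2)"
  shows "D L * moment_gf 0 L = 1"
    and "D L * moment_gf 1 L = (\<Sum>k<L. weight fps_X k)"
    and "D L * moment_gf 2 L = pair_weight fps_X L"
proof (induction L)
  case 0
  {
    case 1
    then show ?case by (simp add: D_def qpoch_def moment_gf_0)
  next
    case 2
    then show ?case by (simp add: moment_gf_0)
  next
    case 3
    then show ?case by (simp add: moment_gf_0 pair_weight_def)
  }
next
  case (Suc L)
  define F where "F = (1 - fps_X ^ (2 * L + 1) :: rat fps)"
  have D: "D (Suc L) = D L * F"
    by (simp add: D_def F_def qpoch_Suc_odd)
  have g: "F * block_gf 0 (2 * L + 1) = 1"
    "F * block_gf 1 (2 * L + 1) = weight fps_X L"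
    "F * block_gf 2 (2 * L + 1) = of_bool (1 \<le> L) * fps_X ^ (4 * L + 2)"
    unfolding F_def by (subst block_gf_times; simp add: weight_def)+
  {
    case 1
    have "D (Suc L) * moment_gf 0 (Suc L) = (D L * moment_gf 0 L) * (F * block_gf 0 (2 * L + 1))"
      unfolding D moment_gf_Suc by (simp add: mult_ac)
    then show ?case
      by (simp only: Suc.IH g) simp
  next
    case 2
    have "{..1::nat} = {0, 1}"
      by auto
    then have "D (Suc L) * moment_gf 1 (Suc L) =
        (D L * moment_gf 0 L) * (F * block_gf 1 (2 * L + 1))
        + (D L * moment_gf 1 L) * (F * block_gf 0 (2 * L + 1))"
      unfolding D moment_gf_Suc by (simp add: algebra_simps)
    then show ?case
      by (simp only: Suc.IH g) simp
  next
    case 3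
    have "{..2::nat} = {0, 1, 2}"
      by auto
    then have "D (Suc L) * moment_gf 2 (Suc L) =
        (D L * moment_gf 0 L) * (F * block_gf 2 (2 * L + 1))
        + (D L * moment_gf 1 L) * (F * block_gf 1 (2 * L + 1))
        + (D L * moment_gf 2 L) * (F * block_gf 0 (2 * L + 1))"
      unfolding D moment_gf_Suc by (simp add: algebra_simps)
    then show ?case
      by (simp only: Suc.IH g) (simp add: pair_weight_def)
  }
qed


subsection \<open>Closed forms\<close>

text \<open>Geometric series in \<open>q ^ 2\<close> and \<open>q ^ 4\<close>; the isolated
  \<open>q ^ 2\<close> comes from part size 1.\<close>

lemma sum_weight_closed:
  "(1 - q ^ 4) * (\<Sum>k<Suc n. weight q k)
     = q ^ 2 * (1 - q ^ 4) + q ^ 3 * (1 + q ^ 2) * (1 - q ^ (2 * n)) + q ^ 6 * (1 - (q ^ (2 * n)) ^ 2)"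
proof (induction n)
  case 0
  show ?case by (simp add: weight_def power2_eq_square)
next
  case (Suc n)
  define Y where "Y = q ^ (2 * n)"
  have w: "weight q (Suc n) = q ^ 3 * Y + q ^ 6 * Y ^ 2"
    by (simp add: weight_def Y_def power_add flip: power_mult)
       (simp add: power2_eq_square power3_eq_cube)
  have Y': "q ^ (2 * Suc n) = q ^ 2 * Y"
    by (simp add: Y_def power2_eq_square)
  show ?case
    unfolding sum.lessThan_Suc[of _ "Suc n"] distrib_left Suc.IH w Y'
    unfolding Y_def[symmetric] by algebra
qed

text \<open>With \<open>p\<close>, \<open>r\<close> odd from 3 to \<open>2 * n + 1\<close>, the five
  summands collect: \<open>q ^ 2 * q ^ p\<close>; \<open>q ^ (2 * p)\<close> alone and times
  \<open>q ^ 2\<close>; \<open>q ^ (p + r)\<close> for \<open>p < r\<close>;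
  \<open>q ^ (p + 2 * r)\<close> for distinct \<open>p\<close>, \<open>r\<close>;
  \<open>q ^ (2 * p + 2 * r)\<close> for \<open>p < r\<close>. With denominators cleared, the
  induction step \<open>Y\<close> to \<open>q ^ 2 * Y\<close> is a polynomial identity.\<close>

lemma pair_weight_closed:
  fixes q :: "rat fps" and n :: nat
  defines "Y \<equiv> q ^ (2 * n)"
  shows "(1 - q^2) * (1 - q^4) * (1 - q^6) * (1 - q^8) * pair_weight q (Suc n)
    = q^5 * (1 - Y) * ((1 - q^4) * (1 - q^6) * (1 - q^8))
      + (q^6 + q^8) * (1 - Y^2) * ((1 - q^2) * (1 - q^6) * (1 - q^8))
      + q^6 * ((1 - Y) * (q^2 - Y)) * ((1 - q^6) * (1 - q^8))
      + q^9 * ((1 - Y) * (q^2 - Y)) * ((1 + q^2) * (1 + Y) + q^2 + Y) * ((1 - q^2) * (1 - q^8))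
      + q^12 * ((1 - Y^2) * (q^4 - Y^2)) * ((1 - q^2) * (1 - q^6))"
  unfolding Y_def
proof (induction n)
  case 0
  show ?case by (simp add: pair_weight_def)
next
  case (Suc n)
  define Y where "Y = q ^ (2 * n)"
  have w: "weight q (Suc n) = q ^ 3 * Y + q ^ 6 * Y ^ 2"
    by (simp add: weight_def Y_def power_add flip: power_mult)
       (simp add: power2_eq_square power3_eq_cube)
  have w2: "of_bool (1 \<le> Suc n) * q ^ (4 * Suc n + 2) = q ^ 6 * Y ^ 2"
    by (simp add: Y_def power_add flip: power_mult)
  have Y': "q ^ (2 * Suc n) = q ^ 2 * Y"
    by (simp add: Y_def power2_eq_square)
  have S: "pair_weight q (Suc (Suc n)) = pair_weight q (Suc n)
      + ((\<Sum>i<Suc n. weight q i) * (q ^ 3 * Y + q ^ 6 * Y ^ 2) + q ^ 6 * Y ^ 2)"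
    unfolding pair_weight_def by (subst sum.lessThan_Suc) (simp only: w w2)
  have "(1 - q^2) * (1 - q^4) * (1 - q^6) * (1 - q^8) * pair_weight q (Suc (Suc n))
     = (1 - q^2) * (1 - q^4) * (1 - q^6) * (1 - q^8) * pair_weight q (Suc n)
       + (1 - q^2) * (1 - q^6) * (1 - q^8) *
         (((1 - q^4) * (\<Sum>i<Suc n. weight q i)) * (q ^ 3 * Y + q ^ 6 * Y ^ 2)
           + (1 - q^4) * q ^ 6 * Y ^ 2)"
    unfolding S by (simp only: algebra_simps)
  then show ?case
    unfolding Suc.IH sum_weight_closed Y' unfolding Y_def[symmetric]
    by algebra
qed

section \<open>Gaussian binomials with lower index 2 and 3\<close>

lemma qpoch_self_Suc: "qpoch x x (Suc n) = qpoch x x n * (1 - x ^ Suc n)"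
  by (simp add: qpoch_def)

lemma qpoch_self_nth_0: "fps_nth x 0 = 0 \<Longrightarrow> fps_nth (qpoch x x n) 0 = (1 :: rat)"
  by (induction n) (simp_all add: qpoch_self_Suc qpoch_def fps_nth_power_0)

lemma qbinom_times_qpoch:
  assumes "fps_nth x 0 = 0" "N \<le> M"
  shows "qbinom x M N * qpoch x x N * qpoch x x (M - N) = qpoch x x M"
proof -
  have "is_unit (qpoch x x N * qpoch x x (M - N))"
    using assms(1) by (simp add: qpoch_self_nth_0)
  then show ?thesis
    using assms(2) by (simp add: qbinom_def mult.assoc)
qed

lemma qpoch_self_neq_0: "fps_nth x 0 = 0 \<Longrightarrow> qpoch x x n \<noteq> (0 :: rat fps)"
  using qpoch_self_nth_0[of x n] by auto

text \<open>The extra factor \<open>x\<close> turns \<open>1 - x ^ (n - 1)\<close> into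
  \<open>x - x ^ n\<close>, which avoids subtraction in exponents; for \<open>n < 2\<close> both
  sides vanish.\<close>

lemma qbinom_2_closed:
  assumes "fps_nth x 0 = 0"
  shows "(1 - x) * (1 - x ^ 2) * (x * qbinom x n 2) = (1 - x ^ n) * (x - x ^ n)"
proof (cases "n < 2")
  case True
  then have "n = 0 \<or> n = 1"
    by auto
  then show ?thesis
    by (auto simp: qbinom_def)
next
  case False
  then obtain m where n: "n = Suc (Suc m)"
    by (metis add_2_eq_Suc le_Suc_ex not_less)
  have "qbinom x n 2 * ((1 - x) * (1 - x ^ 2)) * qpoch x x m
          = (1 - x ^ Suc m) * (1 - x ^ n) * qpoch x x m"
    using qbinom_times_qpoch[OF assms, of 2 n]
    by (simp add: n qpoch_self_Suc numeral_2_eq_2 qpoch_def[of _ _ 0] mult_ac)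
  then have "qbinom x n 2 * ((1 - x) * (1 - x ^ 2)) = (1 - x ^ Suc m) * (1 - x ^ n)"
    using qpoch_self_neq_0[OF assms] by simp
  moreover have "x - x ^ n = x * (1 - x ^ Suc m)"
    by (simp add: n algebra_simps)
  ultimately show ?thesis
    by (simp add: mult_ac)
qed

text \<open>The quotient in front cancels the top factor \<open>1 - x ^ Suc n\<close> of the
  numerator, so the right side is the same as for lower index 2.\<close>

lemma qbinom_3_closed:
  assumes "fps_nth x 0 = 0"
  shows "(1 - x ^ 2) * (1 - x ^ 3) * (x * ((1 - x) / (1 - x ^ Suc n) * qbinom x (Suc n) 3))
           = (1 - x ^ n) * (x - x ^ n)"
proof (cases "n < 2")
  case True
  then have "n = 0 \<or> n = 1"
    by auto
  then show ?thesis
    by (auto simp: qbinom_def)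
next
  case False
  then obtain m where n: "n = Suc (Suc m)"
    by (metis add_2_eq_Suc le_Suc_ex not_less)
  define A where "A = (1 - x) / (1 - x ^ Suc n)"
  have u: "is_unit (1 - x ^ Suc n)"
    using assms by (simp add: fps_nth_power_0)
  then have A: "A * (1 - x ^ Suc n) = 1 - x"
    unfolding A_def by (rule unit_div_mult_self)
  have "qbinom x (Suc n) 3 * ((1 - x) * (1 - x ^ 2) * (1 - x ^ 3)) * qpoch x x m
          = (1 - x ^ Suc m) * (1 - x ^ n) * (1 - x ^ Suc n) * qpoch x x m"
    using qbinom_times_qpoch[OF assms, of 3 "Suc n"]
    by (simp add: n qpoch_self_Suc numeral_2_eq_2 numeral_3_eq_3 qpoch_def[of _ _ 0] mult_ac)
  then have "qbinom x (Suc n) 3 * ((1 - x) * (1 - x ^ 2) * (1 - x ^ 3))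
               = (1 - x ^ Suc m) * (1 - x ^ n) * (1 - x ^ Suc n)"
    using qpoch_self_neq_0[OF assms] by simp
  then have "(1 - x ^ Suc n) * (A * qbinom x (Suc n) 3 * ((1 - x ^ 2) * (1 - x ^ 3)))
      = (1 - x ^ Suc n) * ((1 - x ^ Suc m) * (1 - x ^ n))"
    unfolding A[symmetric] by (simp only: mult_ac)
  moreover have "1 - x ^ Suc n \<noteq> 0"
    using u by (metis not_is_unit_0)
  ultimately have "A * qbinom x (Suc n) 3 * ((1 - x ^ 2) * (1 - x ^ 3))
      = (1 - x ^ Suc m) * (1 - x ^ n)"
    by simp
  moreover have "x - x ^ n = x * (1 - x ^ Suc m)"
    by (simp add: n algebra_simps)
  ultimately show ?thesis
    unfolding A_def[symmetric] by (simp add: mult_ac)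
qed

text \<open>After multiplication by a nonzero common denominator, the bracket agrees summand by
  summand with \<open>pair_weight_closed\<close>.\<close>

lemma bracket_eq_pair_weight:
  fixes q :: "rat fps"
  assumes q: "fps_nth q 0 = 0" and L: "L \<ge> 1"
  shows "q ^ 5 * ((1 - q ^ (2 * L - 2)) / (1 - q ^ 2))
      + (q ^ 6 + q ^ 8) * ((1 - q ^ (4 * L - 4)) / (1 - q ^ 4))
      + q ^ 8 * qbinom (q ^ 2) (L - 1) 2
      + q ^ 11 * ((1 - q ^ 2) / (1 - q ^ (2 * L))) * qbinom (q ^ 2) L 3
          * ((1 + q ^ 2) * (1 + q ^ (2 * L - 2)) + q ^ 2 + q ^ (2 * L - 2))
      + q ^ 16 * qbinom (q ^ 4) (L - 1) 2 = pair_weight q L"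
proof -
  obtain n where n: "L = Suc n"
    using L by (cases L) auto
  define Y where "Y = q ^ (2 * n)"
  have Y: "q ^ (2 * L - 2) = Y" "q ^ (4 * L - 4) = Y ^ 2" "(q ^ 2) ^ n = Y" "(q ^ 4) ^ n = Y ^ 2"
    by (simp_all add: n Y_def flip: power_mult)
  have unit: "is_unit (1 - q ^ k)" if "k > 0" for k
    using that q by (simp add: fps_nth_power_0 power_0_left)
  have q0: "fps_nth (q ^ 2) 0 = 0" "fps_nth (q ^ 4) 0 = 0"
    using q by (simp_all add: fps_nth_power_0)
  define a1 where "a1 = (1 - Y) / (1 - q ^ 2)"
  define a2 where "a2 = (1 - Y ^ 2) / (1 - q ^ 4)"
  define a3 where "a3 = qbinom (q ^ 2) n 2"
  define a4 where "a4 = (1 - q ^ 2) / (1 - q ^ (2 * L)) * qbinom (q ^ 2) L 3"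
  define a5 where "a5 = qbinom (q ^ 4) n 2"
  have pow: "(q ^ 2) ^ 2 = q ^ 4" "(q ^ 2) ^ 3 = q ^ 6" "(q ^ 4) ^ 2 = q ^ 8"
    "(q ^ 2) ^ Suc n = q ^ (2 * L)"
    by (simp_all add: n del: power_Suc flip: power_mult)
  have a: "(1 - q ^ 2) * a1 = 1 - Y"
    "(1 - q ^ 4) * a2 = 1 - Y ^ 2"
    "(1 - q ^ 2) * (1 - q ^ 4) * (q ^ 2 * a3) = (1 - Y) * (q ^ 2 - Y)"
    "(1 - q ^ 4) * (1 - q ^ 6) * (q ^ 2 * a4) = (1 - Y) * (q ^ 2 - Y)"
    "(1 - q ^ 4) * (1 - q ^ 8) * (q ^ 4 * a5) = (1 - Y ^ 2) * (q ^ 4 - Y ^ 2)"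
    using qbinom_2_closed[OF q0(1), of n, unfolded pow Y]
      qbinom_3_closed[OF q0(1), of n, unfolded pow Y, folded n]
      qbinom_2_closed[OF q0(2), of n, unfolded pow Y]
    unfolding a1_def a2_def a3_def a4_def a5_def mult.commute[of _ "_ / _"]
    by (simp_all only: unit_div_mult_self unit zero_less_numeral)
  let ?M = "(1 - q^2) * (1 - q^4) * (1 - q^6) * (1 - q^8)"
  define T where "T = q ^ 5 * a1 + (q ^ 6 + q ^ 8) * a2 + q ^ 8 * a3
      + q ^ 11 * a4 * ((1 + q ^ 2) * (1 + Y) + q ^ 2 + Y) + q ^ 16 * a5"
  \<comment> \<open>Splitting \<open>q ^ 8\<close>, \<open>q ^ 11\<close> as \<open>q ^ 6\<close>,
    \<open>q ^ 9\<close> times \<open>q ^ 2\<close>, and \<open>q ^ 16\<close> as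
    \<open>q ^ 12 * q ^ 4\<close>, supplies the extra factor \<open>x\<close> of the closed
    forms.\<close>
  have "?M * T = q^5 * ((1 - q^2) * a1) * ((1 - q^4) * (1 - q^6) * (1 - q^8))
      + (q^6 + q^8) * ((1 - q^4) * a2) * ((1 - q^2) * (1 - q^6) * (1 - q^8))
      + q^6 * ((1 - q^2) * (1 - q^4) * (q^2 * a3)) * ((1 - q^6) * (1 - q^8))
      + q^9 * ((1 - q^4) * (1 - q^6) * (q^2 * a4)) * ((1 + q^2) * (1 + Y) + q^2 + Y) * ((1 - q^2) * (1 - q^8))
      + q^12 * ((1 - q^4) * (1 - q^8) * (q^4 * a5)) * ((1 - q^2) * (1 - q^6))"
    unfolding T_def by algebra
  also have "\<dots> = ?M * pair_weight q L"
    unfolding a pair_weight_closed[of q n, folded Y_def n] ..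
  finally have "T = pair_weight q L"
    using unit[of 2] unit[of 4] unit[of 6] unit[of 8] by auto
  then show ?thesis
    unfolding Y unfolding n diff_Suc_1 T_def a1_def a2_def a3_def a4_def a5_def by (simp only: mult.assoc)
qed

section \<open>From moments to the double series\<close>

lemma a2_eq_card: "a2 L m n = card {lam \<in> odd_partitions L n. two_hooks lam = m}"
  by (simp add: a2_def odd_partitions_def two_hooks_def conj_assoc)

text \<open>Convergence is checked coefficientwise: at \<open>n\<close> only pairs
  \<open>(n, m)\<close> with \<open>m\<close> a value of \<open>two_hooks\<close> on
  \<open>odd_partitions L n\<close> contribute, and these are finitely many.\<close>

lemma has_sum_moment_gf:
  "((\<lambda>(n, m). of_nat ((m choose i) * a2 L m n) * fps_X ^ n) has_sum moment_gf i L) UNIV"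
proof (rule has_sum_fpsI)
  fix n
  let ?F = "\<lambda>(n, m). of_nat ((m choose i) * a2 L m n) * fps_X ^ n :: rat fps"
  let ?M = "two_hooks ` odd_partitions L n"
  let ?S = "{x \<in> UNIV. fps_nth (?F x) n \<noteq> 0}"
  have F: "fps_nth (?F (k, m)) n = (if k = n then of_nat ((m choose i) * a2 L m n) else 0)" for k m
    by (simp add: fps_X_power_mult_right_nth fps_of_nat[symmetric] del: of_nat_mult)
  have "m \<in> ?M" if "a2 L m n \<noteq> 0" for m
  proof -
    have "{lam \<in> odd_partitions L n. two_hooks lam = m} \<noteq> {}"
      using that unfolding a2_eq_card by (metis card.empty)
    then show ?thesis
      by auto
  qed
  then have sub: "?S \<subseteq> Pair n ` ?M"
    by (auto simp: F split: if_splits simp del: of_nat_mult)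
  moreover have fin: "finite ?M"
    by (simp add: finite_odd_partitions)
  ultimately show "finite ?S"
    by (meson finite_imageI finite_subset)
  have "(\<Sum>lam | lam \<in> odd_partitions L n \<and> two_hooks lam = m. two_hooks lam choose i)
          = (m choose i) * a2 L m n" for m
  proof -
    have "(\<Sum>lam | lam \<in> odd_partitions L n \<and> two_hooks lam = m. two_hooks lam choose i)
            = (\<Sum>lam | lam \<in> odd_partitions L n \<and> two_hooks lam = m. m choose i)"
      by (rule sum.cong) auto
    then show ?thesis
      by (simp add: a2_eq_card mult.commute)
  qed
  moreover have "(\<Sum>lam\<in>odd_partitions L n. two_hooks lam choose i)
      = (\<Sum>m\<in>?M. \<Sum>lam | lam \<in> odd_partitions L n \<and> two_hooks lam = m. two_hooks lam choose i)"
    by (rule sum.image_gen) (rule finite_odd_partitions)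
  ultimately have "fps_nth (moment_gf i L) n = of_nat (\<Sum>m\<in>?M. (m choose i) * a2 L m n)"
    by (simp only: moment_gf_def fps_nth_Abs_fps)
  also have "\<dots> = (\<Sum>x\<in>Pair n ` ?M. fps_nth (?F x) n)"
    by (subst sum.reindex) (auto simp: F inj_on_def simp del: of_nat_mult)
  also have "\<dots> = (\<Sum>x\<in>?S. fps_nth (?F x) n)"
    using fin sub by (intro sum.mono_neutral_right) auto
  finally show "fps_nth (moment_gf i L) n = (\<Sum>x\<in>?S. fps_nth (?F x) n)" .
qed

(* The last exponent in the factor (1 + q^2) (1 + q^(2L-2)) + q^2 + q^(2L-2) is printed as 2L in
   the source. With 2L the identity fails for L = 3 at q^15 (left side 34, right side 33). *)
theorem theorem2p4:
  fixes L :: nat and q :: "rat fps"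
  assumes "L \<ge> 1" and "q = fps_X"
  shows "((\<lambda>(n, m). of_nat ((m choose 2) * a2 L m n) * q ^ n) has_sum
           (1 / qpoch q (q ^ 2) L *
             (q ^ 5 * ((1 - q ^ (2 * L - 2)) / (1 - q ^ 2))
              + (q ^ 6 + q ^ 8) * ((1 - q ^ (4 * L - 4)) / (1 - q ^ 4))
              + q ^ 8 * qbinom (q ^ 2) (L - 1) 2
              + q ^ 11 * ((1 - q ^ 2) / (1 - q ^ (2 * L))) * qbinom (q ^ 2) L 3
                  * ((1 + q ^ 2) * (1 + q ^ (2 * L - 2)) + q ^ 2 + q ^ (2 * L - 2))
              + q ^ 16 * qbinom (q ^ 4) (L - 1) 2)))
         (UNIV :: (nat \<times> nat) set)"
proof -
  \<comment> \<open>The zeroth moment series is an explicit inverse.\<close>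
  have "is_unit (qpoch q (q ^ 2) L)"
    using qpoch_moment_gf(1)[of L] unfolding \<open>q = fps_X\<close> by (metis dvdI)
  then have "1 / qpoch q (q ^ 2) L * (qpoch q (q ^ 2) L * moment_gf 2 L) = moment_gf 2 L"
    unfolding mult.assoc[symmetric] by (simp only: unit_div_mult_self mult_1_left)
  moreover have "fps_nth q 0 = 0"
    by (simp add: assms(2))
  ultimately show ?thesis
    using has_sum_moment_gf[of 2 L] qpoch_moment_gf(3)[of L]
    by (simp only: bracket_eq_pair_weight[OF _ assms(1)] assms(2))
qed

end
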